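(* Let $X$ be a metrizable separable space. Then each compact convex subspace $\mathcal K\subset SC_p(X)$ is metrizable.
   Context: A function $f:X\to Y$ between topological spaces is scatteredly continuous if for each non-empty subspace $A\subset X$ the restriction $f|A:A\to Y$ has a point of continuity. $SC_p(X)\subset\mathbb R^X$ denotes the linear space of all scatteredly continuous real-valued functions on $X$, endowed with the topology of pointwise convergence. *)

theory Defs
  imports "HOL-Analysis.Analysis"
begin

definition scatteredly_continuous ::
    "'a topology \<Rightarrow> 'b topology \<Rightarrow> ('a \<Rightarrow> 'b) \<Rightarrow> bool" where
  "scatteredly_continuous X Y f \<longleftrightarrow>
     f \<in> topspace X \<rightarrow> topspace Y \<and>
     (\<forall>A. A \<subseteq> topspace X \<and> A \<noteq> {} \<longrightarrow>
        (\<exists>a\<in>A. topcontinuous_at (subtopology X A) Y f a))"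

text \<open>Functions on \<open>topspace X\<close> are represented, as in \<^const>\<open>product_topology\<close>, by their
  extensional representatives (undefined outside \<open>topspace X\<close>).\<close>

definition SC_p :: "'a topology \<Rightarrow> ('a \<Rightarrow> real) topology" where
  "SC_p X = subtopology (powertop_real (topspace X))
              {f. scatteredly_continuous X euclideanreal f}"

text \<open>The function type is not an instance of \<^class>\<open>real_vector\<close>, so \<^const>\<open>convex\<close> does not apply.
  This is its definition for the pointwise operations on real functions over \<open>I\<close>; restricting
  to \<open>I\<close> keeps convex combinations extensional.\<close>

definition convex_funs :: "'a set \<Rightarrow> ('a \<Rightarrow> real) set \<Rightarrow> bool" where
  "convex_funs I K \<longleftrightarrow>
     (\<forall>f\<in>K. \<forall>g\<in>K. \<forall>u\<ge>0. \<forall>v\<ge>0. u + v = 1 \<longrightarrow>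
        (\<lambda>x\<in>I. u * f x + v * g x) \<in> K)"

lemma topspace_SC_p:
  "topspace (SC_p X) = {f \<in> extensional (topspace X). scatteredly_continuous X euclideanreal f}"
  by (auto simp: SC_p_def PiE_def)

end

theory Submission
  imports Defs
begin

text \<open>
  Every nonempty \<open>A \<subseteq> X\<close> has a nonempty relatively open subset on which all members of \<open>K\<close> are
  continuous. Removing such pieces repeatedly exhausts \<open>X\<close>, after countably many steps since \<open>X\<close> is
  hereditarily Lindelof. The union \<open>S\<close> of countable dense subsets of the pieces then separates the
  points of \<open>K\<close>, so the compact space \<open>K\<close> embeds into the metrizable space \<open>\<real>\<^sup>S\<close>.

  To find the open piece it suffices that the members of \<open>K\<close>, restricted to any nonempty set, have
  a common point of continuity. If they do not, this already fails on a countable set \<open>B\<close>. As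
  each \<open>f \<in> K\<close> has a point of continuity on \<open>B\<close>, Baire's theorem in \<open>K\<close> with the pointwise topology,
  together with convexity, yields a ball of \<open>B\<close> on which every member of \<open>K\<close> is bounded. On that ball,
  \<open>K\<close> is complete in the supremum metric and is the countable union over points \<open>x\<close> of the closed
  sets of functions continuous at \<open>x\<close>. By Baire again one of these sets has interior,
  and by convexity it is all of \<open>K\<close>.
\<close>

section \<open>Relative continuity, Baire category and segments\<close>

text \<open>\<open>d\<close> is an arbitrary function rather than a metric, so that the same notion
  serves for the metric of the space and for its pullback to \<open>nat\<close>.\<close>

definition cont_on_at :: "('a \<Rightarrow> 'a \<Rightarrow> real) \<Rightarrow> 'a set \<Rightarrow> ('a \<Rightarrow> real) \<Rightarrow> 'a \<Rightarrow> bool" where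
  "cont_on_at d A f x \<longleftrightarrow> (\<forall>e>0. \<exists>r>0. \<forall>y\<in>A. d x y < r \<longrightarrow> \<bar>f y - f x\<bar> < e)"

text \<open>A complete \<open>S\<close> is completely metrizable, so if every \<open>F i\<close> had
  empty interior in \<open>S\<close>, the union would too; but it contains \<open>S\<close>. The
  form is chosen for two applications, to \<open>K\<close> with pointwise convergence and to a copy
  of \<open>K\<close> with the supremum metric.\<close>

lemma Baire_closed_cover:
  fixes S :: "'a::metric_space set" and F :: "'i::countable \<Rightarrow> 'a set"
  assumes "complete S" "S \<noteq> {}" "\<And>i. closedin (top_of_set S) (F i)" "S \<subseteq> (\<Union>i. F i)"
  obtains i x U where "open U" "x \<in> S \<inter> U" "S \<inter> U \<subseteq> F i"
proof -
  interpret sub: Submetric UNIV dist S by unfold_locales auto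
  have "sub.sub.mcomplete"
    unfolding sub.sub.mcomplete_def
  proof (intro allI impI)
    fix \<sigma> assume "sub.sub.MCauchy \<sigma>"
    then have "Cauchy \<sigma>" "\<And>n. \<sigma> n \<in> S"
      unfolding sub.sub.MCauchy_def Cauchy_def by auto
    then obtain x where "x \<in> S" "\<sigma> \<longlonglongrightarrow> x" using assms(1) unfolding complete_def by blast
    then show "\<exists>x. limitin sub.sub.mtopology \<sigma> x sequentially"
      using \<open>\<And>n. \<sigma> n \<in> S\<close>
      by (auto simp: sub.mtopology_submetric limitin_subtopology)
  qed
  then have "completely_metrizable_space (top_of_set S)"
    using sub.sub.completely_metrizable_space_mtopology by (simp add: sub.mtopology_submetric)
  have "\<exists>T\<in>range F. top_of_set S interior_of T \<noteq> {}"
  proof (rule ccontr)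
    assume "\<not> (\<exists>T\<in>range F. top_of_set S interior_of T \<noteq> {})"
    then have "top_of_set S interior_of \<Union>(range F) = {}"
      using assms(3) \<open>completely_metrizable_space (top_of_set S)\<close>
      by (intro Baire_category_alt) auto
    moreover have "top_of_set S interior_of S \<subseteq> top_of_set S interior_of \<Union>(range F)"
      using assms(4) by (intro interior_of_mono) auto
    moreover have "top_of_set S interior_of S = S"
      by (metis interior_of_topspace topspace_euclidean_subtopology)
    ultimately show False using assms(2) by auto
  qed
  then obtain i x where "x \<in> top_of_set S interior_of (F i)" by auto
  then obtain T where "openin (top_of_set S) T" "x \<in> T" "T \<subseteq> F i"
    unfolding interior_of_def by auto
  then show ?thesis using that unfolding openin_open by blast
qed

text \<open>Since \<open>u > 0\<close>, the equation of the segment can be solved for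
  \<open>g\<close>. This carries continuity at \<open>x\<close> from a relatively open part of a
  convex set to the whole set.\<close>

lemma cont_on_at_convex_combination:
  assumes "cont_on_at d A f x" "cont_on_at d A (\<lambda>y. (1 - u) * f y + u * g y) x" "u > 0"
  shows "cont_on_at d A g x"
  unfolding cont_on_at_def
proof (intro allI impI)
  fix e :: real assume e: "e > 0"
  \<comment> \<open>Chosen so that \<open>c + \<bar>1 - u\<bar> * c = u * e\<close>, the error left
    after solving for \<open>u * g\<close>.\<close>
  define c where "c = u * e / (\<bar>1 - u\<bar> + 1)"
  have c: "c > 0" using e assms(3) by (simp add: c_def)
  obtain r1 where r1: "r1 > 0" "\<forall>y\<in>A. d x y < r1 \<longrightarrow> \<bar>f y - f x\<bar> < c"
    using assms(1) c unfolding cont_on_at_def by blast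
  obtain r2 where r2: "r2 > 0" "\<forall>y\<in>A. d x y < r2 \<longrightarrow> \<bar>((1 - u) * f y + u * g y) - ((1 - u) * f x + u * g x)\<bar> < c"
    using assms(2) c unfolding cont_on_at_def by blast
  show "\<exists>r>0. \<forall>y\<in>A. d x y < r \<longrightarrow> \<bar>g y - g x\<bar> < e"
  proof (intro exI[of _ "min r1 r2"] conjI ballI impI)
    fix y assume y: "y \<in> A" "d x y < min r1 r2"
    have "u * \<bar>g y - g x\<bar> = \<bar>u * (g y - g x)\<bar>" using assms(3) by (simp add: abs_mult)
    also have "u * (g y - g x) = (((1 - u) * f y + u * g y) - ((1 - u) * f x + u * g x)) - (1 - u) * (f y - f x)"
      by (simp add: algebra_simps)
    also have "\<bar>\<dots>\<bar> \<le> \<bar>((1 - u) * f y + u * g y) - ((1 - u) * f x + u * g x)\<bar> + \<bar>1 - u\<bar> * \<bar>f y - f x\<bar>"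
      by (metis abs_mult abs_triangle_ineq4)
    also have "\<dots> < c + \<bar>1 - u\<bar> * c"
      using r1 r2 y by (intro add_less_le_mono mult_left_mono) (auto intro: less_imp_le)
    also have "\<dots> = u * e" 
    proof -
      have "c * (\<bar>1 - u\<bar> + 1) = u * e" unfolding c_def by (simp add: add_nonneg_eq_0_iff)
      then show ?thesis by (simp add: algebra_simps)
    qed
    finally show "\<bar>g y - g x\<bar> < e" using assms(3) by simp
  qed (use r1 r2 in auto)
qed

lemma cont_on_at_uniform_limit:
  assumes x: "x \<in> A" and h: "\<And>e. e > 0 \<Longrightarrow> \<exists>f. cont_on_at d A f x \<and> (\<forall>y\<in>A. \<bar>f y - h y\<bar> < e)"
  shows "cont_on_at d A h x"
  unfolding cont_on_at_def
proof (intro allI impI)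
  fix e :: real assume "e > 0"
  then obtain f where f: "cont_on_at d A f x" "\<forall>y\<in>A. \<bar>f y - h y\<bar> < e/3"
    using h[of "e/3"] by auto
  then obtain r where r: "r > 0" "\<forall>y\<in>A. d x y < r \<longrightarrow> \<bar>f y - f x\<bar> < e/3"
    using \<open>e > 0\<close> unfolding cont_on_at_def by (meson divide_pos_pos zero_less_numeral)
  show "\<exists>r>0. \<forall>y\<in>A. d x y < r \<longrightarrow> \<bar>h y - h x\<bar> < e"
  proof (intro exI[of _ r] conjI ballI impI)
    fix y assume "y \<in> A" "d x y < r"
    then show "\<bar>h y - h x\<bar> < e" 
      using r(2)[rule_format, of y] f(2)[rule_format, of y] f(2)[rule_format, OF x] unfolding abs_less_iff by linarith
  qed (use r in auto)
qed

text \<open>The segment is a continuous path in the product topology starting at \<open>f\<close>.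
  Keeping \<open>u\<close> strictly positive lets the far end \<open>g\<close> be recovered from
  \<open>f\<close> and the point in \<open>U\<close>.\<close>

lemma segment_meets_open:
  fixes f g :: "'i \<Rightarrow> real"
  assumes "open U" "f \<in> U"
  obtains u where "0 < u" "u < 1" "(\<lambda>i. (1 - u) * f i + u * g i) \<in> U"
proof -
  let ?p = "\<lambda>u. \<lambda>i. (1 - u) * f i + u * g i"
  have "continuous_on UNIV ?p" by (intro continuous_intros)
  then have "open (?p -` U)" using assms(1) by (simp add: open_vimage)
  moreover have "0 \<in> ?p -` U" using assms(2) by simp
  ultimately obtain e where e: "e > 0" "ball 0 e \<subseteq> ?p -` U" by (meson openE)
  show thesis
    by (rule that[of "min (e/2) (1/2)"]) (use e in \<open>auto simp: dist_real_def min_def subset_iff split: if_splits\<close>)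
qed

section \<open>Common points of continuity over a countable index set\<close>

text \<open>Uniform limits preserve continuity at a point; pointwise limits do not, hence the
  passage to bounded functions with the supremum metric.\<close>

lemma closedin_cont_on_at_bcontfun:
  fixes S :: "(nat \<Rightarrow>\<^sub>C real) set"
  assumes "j \<in> A"
  shows "closedin (top_of_set S) {h \<in> S. cont_on_at d A (apply_bcontfun h) j}"
proof -
  have "closed {h. cont_on_at d A (apply_bcontfun h) j}"
  proof (subst closure_subset_eq[symmetric], rule subsetI, simp only: mem_Collect_eq)
    fix h :: "nat \<Rightarrow>\<^sub>C real" assume h: "h \<in> closure {h. cont_on_at d A (apply_bcontfun h) j}"
    show "cont_on_at d A (apply_bcontfun h) j"
    proof (rule cont_on_at_uniform_limit[OF assms])
      fix e :: real assume "e > 0"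
      then obtain g :: "nat \<Rightarrow>\<^sub>C real" where "cont_on_at d A g j" "dist g h < e" using h unfolding closure_approachable by auto
      then show "\<exists>f. cont_on_at d A f j \<and> (\<forall>y\<in>A. \<bar>f y - h y\<bar> < e)"
        by (metis dist_fun_lt_imp_dist_val_lt dist_real_def)
    qed
  qed
  moreover have "{h \<in> S. cont_on_at d A (apply_bcontfun h) j} = S \<inter> {h. cont_on_at d A (apply_bcontfun h) j}"
    by auto
  ultimately show ?thesis by (simp add: closedin_closed_Int)
qed

text \<open>Stated over \<^typ>\<open>nat\<close> so that \<open>K\<close> with the topology of pointwise convergence lives in a metric
  type; \<open>d\<close> is only a pseudometric and need not be symmetric.\<close>

lemma common_continuity_point_nat:
  fixes d :: "nat \<Rightarrow> nat \<Rightarrow> real" and K :: "(nat \<Rightarrow> real) set"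
  assumes refl: "\<And>i. d i i = 0" and tri: "\<And>i j k. d i k \<le> d i j + d j k"
    and K: "compact K"
    and conv: "\<And>f g u. f \<in> K \<Longrightarrow> g \<in> K \<Longrightarrow> 0 < u \<Longrightarrow> u < 1 \<Longrightarrow> (\<lambda>i. (1 - u) * f i + u * g i) \<in> K"
    and scat: "\<And>f A. f \<in> K \<Longrightarrow> A \<noteq> {} \<Longrightarrow> \<exists>a\<in>A. cont_on_at d A f a"
  obtains i where "\<And>f. f \<in> K \<Longrightarrow> cont_on_at d UNIV f i"
proof (cases "K = {}")
  case True
  then show ?thesis using that by blast
next
  case False
  \<comment> \<open>Baire's theorem in \<open>K\<close> with pointwise convergence\<close>
  define C where "C = (\<lambda>(i, n). {f \<in> K. \<forall>j. d i j < 1 / Suc n \<longrightarrow> \<bar>f j - f i\<bar> \<le> 1})"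
  have "\<exists>p x U. open U \<and> x \<in> K \<inter> U \<and> K \<inter> U \<subseteq> C p"
  proof (rule Baire_closed_cover[of K C])
    show "complete K" using K by (rule compact_imp_complete)
    show "K \<noteq> {}" by fact
    show "closedin (top_of_set K) (C p)" for p
    proof -
      obtain i n where p: "p = (i, n)" by fastforce
      \<comment> \<open>The non-strict inequality makes each constraint closed under pointwise
        limits. The bound 1 is arbitrary: only boundedness near \<open>i\<close> is extracted from
        it.\<close>
      have "closed {f :: nat \<Rightarrow> real. \<bar>f j - f i\<bar> \<le> 1}" for j
        by (intro closed_Collect_le continuous_intros continuous_on_product_coordinates)
      then have "closed (\<Inter>j\<in>{j. d i j < 1 / Suc n}. {f :: nat \<Rightarrow> real. \<bar>f j - f i\<bar> \<le> 1})" by blast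
      moreover have "C p = K \<inter> (\<Inter>j\<in>{j. d i j < 1 / Suc n}. {f. \<bar>f j - f i\<bar> \<le> 1})"
        unfolding C_def p by auto
      ultimately show ?thesis by (simp add: closedin_closed_Int)
    qed
    show "K \<subseteq> (\<Union>p. C p)"
    proof
      fix f assume f: "f \<in> K"
      then obtain i where "cont_on_at d UNIV f i" using scat[of f UNIV] by auto
      then obtain r where r: "r > 0" "\<forall>j. d i j < r \<longrightarrow> \<bar>f j - f i\<bar> < 1"
        unfolding cont_on_at_def by (metis UNIV_I zero_less_one)
      then obtain n where "1 / Suc n < r" using nat_approx_posE by blast
      then have "f \<in> C (i, n)" using f r unfolding C_def by (auto intro: less_imp_le)
      then show "f \<in> (\<Union>p. C p)" by blast
    qed
  qed blast
  then obtain i n f0 U where U: "open U" "f0 \<in> K \<inter> U" "K \<inter> U \<subseteq> C (i, n)" by force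
  define N where "N = {j. d i j < 1 / Suc n}"
  have i: "i \<in> N" by (simp add: N_def refl)
  have bounded_N: "\<exists>b. \<forall>j\<in>N. \<bar>h j\<bar> \<le> b" if h: "h \<in> K" for h
  proof -
    \<comment> \<open>Move from \<open>f0\<close> slightly towards \<open>h\<close> without leaving
      \<open>U\<close>. Both \<open>f0\<close> and the resulting \<open>g\<close> vary by at most 1
      from their values at \<open>i\<close> on \<open>N\<close>, so solving for \<open>h\<close>
      bounds its variation by \<open>2 / u\<close>.\<close>
    obtain u where u: "0 < u" "u < 1" "(\<lambda>i. (1 - u) * f0 i + u * h i) \<in> U"
      using segment_meets_open[of U f0 h] U by auto
    define g where "g = (\<lambda>i. (1 - u) * f0 i + u * h i)"
    have "g \<in> C (i, n)" using U u conv[of f0 h u] h by (auto simp: g_def)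
    moreover have "f0 \<in> C (i, n)" using U by auto
    ultimately have b: "\<bar>g j - g i\<bar> \<le> 1" "\<bar>f0 j - f0 i\<bar> \<le> 1" if "j \<in> N" for j
      using that by (auto simp: C_def N_def)
    have "\<bar>h j\<bar> \<le> \<bar>h i\<bar> + 2 / u" if j: "j \<in> N" for j
    proof -
      have "u * (h j - h i) = (g j - g i) - (1 - u) * (f0 j - f0 i)"
        by (simp add: g_def algebra_simps)
      moreover have "\<bar>(1 - u) * (f0 j - f0 i)\<bar> \<le> 1"
        using b(2)[OF j] u by (simp add: abs_mult mult_le_one)
      ultimately have "\<bar>u * (h j - h i)\<bar> \<le> 2" using b(1)[OF j] by linarith
      then have "\<bar>h j - h i\<bar> * u \<le> 2" using u by (metis abs_mult abs_of_pos mult.commute)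
      then have "\<bar>h j - h i\<bar> \<le> 2 / u" using u by (simp only: pos_le_divide_eq)
      then show ?thesis by linarith
    qed
    then show ?thesis by blast
  qed
  \<comment> \<open>Baire's theorem in \<open>K\<close> restricted to \<open>N\<close>, with the supremum metric\<close>
  define \<phi> where "\<phi> = (\<lambda>f. Bcontfun (\<lambda>j. if j \<in> N then f j else 0) :: nat \<Rightarrow>\<^sub>C real)"
  have \<phi>: "apply_bcontfun (\<phi> f) j = (if j \<in> N then f j else 0)" if f: "f \<in> K" for f j
  proof -
    obtain b where "\<forall>j\<in>N. \<bar>f j\<bar> \<le> b" using bounded_N[OF f] by blast
    \<comment> \<open>On the discrete space \<open>nat\<close> only boundedness is at stake; the
      default 0 extends the bound on \<open>N\<close> to all indices.\<close>
    then have "(\<lambda>j. if j \<in> N then f j else 0) \<in> bcontfun"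
      by (intro bcontfun_normI[of _ "max b 0"]) auto
    then show ?thesis by (simp add: \<phi>_def Bcontfun_inverse)
  qed
  have cont_\<phi>: "cont_on_at d N (\<phi> f) j \<longleftrightarrow> cont_on_at d N f j" if "f \<in> K" "j \<in> N" for f j
    unfolding cont_on_at_def using that by (simp add: \<phi>)
  \<comment> \<open>Pointwise compactness supplies a candidate limit along a subsequence; the Cauchy
    condition for the supremum metric then makes the whole sequence converge to it
    uniformly.\<close>
  have "complete (\<phi> ` K)"
    unfolding complete_def
  proof (intro allI impI)
    fix s assume s: "(\<forall>n. s n \<in> \<phi> ` K) \<and> Cauchy s"
    then have "\<forall>n. \<exists>f. f \<in> K \<and> s n = \<phi> f" by blast
    then obtain f where f: "\<And>n. f n \<in> K" "\<And>n. s n = \<phi> (f n)" by (auto dest!: choice)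
    obtain g r where g: "g \<in> K" "strict_mono r" "(f \<circ> r) \<longlonglongrightarrow> g"
      using compact_imp_seq_compact[OF K] f(1) unfolding seq_compact_def by blast
    have lim: "(\<lambda>n. s (r n) j) \<longlonglongrightarrow> \<phi> g j" for j
    proof -
      have "continuous_on UNIV (\<lambda>h :: nat \<Rightarrow> real. h j)" by (rule continuous_on_product_coordinates)
      then have "(\<lambda>n. (f \<circ> r) n j) \<longlonglongrightarrow> g j"
        using g(3) continuous_on_tendsto_compose[of UNIV "\<lambda>h. h j" "f \<circ> r" g] by simp
      then show ?thesis by (simp add: f(2) \<phi> f(1) g(1))
    qed
    have "s \<longlonglongrightarrow> \<phi> g"
    proof (rule metric_LIMSEQ_I)
      fix e :: real assume e: "e > 0"
      then obtain m where m: "\<And>p q. p \<ge> m \<Longrightarrow> q \<ge> m \<Longrightarrow> dist (s p) (s q) < e/2"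
        using s unfolding Cauchy_def by (meson half_gt_zero)
      have "dist (s p) (\<phi> g) < e" if p: "p \<ge> m" for p
      proof -
        have "dist (s p j) (\<phi> g j) \<le> e/2" for j
        proof (rule Lim_bounded)
          show "(\<lambda>n. dist (s p j) (s (r n) j)) \<longlonglongrightarrow> dist (s p j) (\<phi> g j)"
            by (intro tendsto_intros lim)
          show "\<forall>n\<ge>m. dist (s p j) (s (r n) j) \<le> e/2"
          proof (intro allI impI)
            fix n assume "n \<ge> m"
            then have "dist (s p) (s (r n)) < e/2"
              using m[OF p] seq_suble[OF g(2), of n] by simp
            then show "dist (s p j) (s (r n) j) \<le> e/2"
              by (intro less_imp_le dist_fun_lt_imp_dist_val_lt)
          qed
        qed
        then have "dist (s p) (\<phi> g) \<le> e/2" by (rule dist_bound)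
        then show ?thesis using e by simp
      qed
      then show "\<exists>m. \<forall>p\<ge>m. dist (s p) (\<phi> g) < e" by blast
    qed
    then show "\<exists>l\<in>\<phi> ` K. s \<longlonglongrightarrow> l" using g(1) by blast
  qed
  \<comment> \<open>Putting \<open>j \<in> N\<close> inside the sets makes those with index outside
    \<open>N\<close> empty, so the cover can be indexed by all of \<open>nat\<close>.\<close>
  then have "\<exists>j x U. open U \<and> x \<in> \<phi> ` K \<inter> U \<and> \<phi> ` K \<inter> U \<subseteq> {h \<in> \<phi> ` K. j \<in> N \<and> cont_on_at d N h j}"
  proof (rule Baire_closed_cover[of _ "\<lambda>j. {h \<in> \<phi> ` K. j \<in> N \<and> cont_on_at d N h j}"])
    show "\<phi> ` K \<noteq> {}" using False by simp
    show "closedin (top_of_set (\<phi> ` K)) {h \<in> \<phi> ` K. j \<in> N \<and> cont_on_at d N h j}" for j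
      using closedin_cont_on_at_bcontfun[of j N "\<phi> ` K" d] by (cases "j \<in> N") auto
    show "\<phi> ` K \<subseteq> (\<Union>j. {h \<in> \<phi> ` K. j \<in> N \<and> cont_on_at d N h j})"
      using scat[of _ N] i cont_\<phi> by fastforce
  qed blast
  then obtain j f V where V: "open V" "f \<in> K" "\<phi> f \<in> V"
      and sub: "\<phi> ` K \<inter> V \<subseteq> {h \<in> \<phi> ` K. j \<in> N \<and> cont_on_at d N h j}"
    by blast
  have j: "j \<in> N" and contf: "cont_on_at d N f j" using V sub cont_\<phi> by auto
  have "cont_on_at d UNIV g j" if g: "g \<in> K" for g
  proof -
    obtain e where e: "e > 0" "ball (\<phi> f) e \<subseteq> V" using V(1,3) by (meson openE)
    \<comment> \<open>The summand 1 keeps \<open>b\<close> positive when the two functions coincide;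
      \<open>u * b \<le> e\<close> then places the point at parameter \<open>u\<close> of the
      segment inside the ball.\<close>
    define b where "b = dist (\<phi> f) (\<phi> g) + 1"
    have b: "dist (\<phi> f) (\<phi> g) < b" "b > 0" by (simp_all add: b_def add_nonneg_pos)
    define u where "u = min (1/2) (e / b)"
    have u: "0 < u" "u < 1" "u * b \<le> e" using e b by (auto simp: u_def min_def field_simps)
    define h where "h = (\<lambda>i. (1 - u) * f i + u * g i)"
    have h: "h \<in> K" using conv V(2) g u by (simp add: h_def)
    have "dist (\<phi> f) (\<phi> h) \<le> u * dist (\<phi> f) (\<phi> g)"
    proof (rule dist_bound)
      fix k
      have "f k - h k = u * (f k - g k)" by (simp add: h_def algebra_simps)
      then have "dist (\<phi> f k) (\<phi> h k) = u * dist (\<phi> f k) (\<phi> g k)"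
        using u by (simp add: \<phi> V(2) g h dist_real_def abs_mult)
      also have "\<dots> \<le> u * dist (\<phi> f) (\<phi> g)" using u(1) by (intro mult_left_mono dist_bounded) simp
      finally show "dist (\<phi> f k) (\<phi> h k) \<le> u * dist (\<phi> f) (\<phi> g)" .
    qed
    also have "\<dots> < u * b" using u b by simp
    finally have "\<phi> h \<in> ball (\<phi> f) e" using u(3) by simp
    then have "\<phi> h \<in> V" using e(2) by blast
    then have "cont_on_at d N h j" using sub h cont_\<phi>[OF h j] by blast
    then have gN: "cont_on_at d N g j"
      using cont_on_at_convex_combination[OF contf, of u g] u(1) by (simp add: h_def)
    show ?thesis
      unfolding cont_on_at_def
    proof (intro allI impI)
      fix e :: real assume "e > 0"
      then obtain r where r: "r > 0" "\<forall>k\<in>N. d j k < r \<longrightarrow> \<bar>g k - g j\<bar> < e"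
        using gN unfolding cont_on_at_def by blast
      \<comment> \<open>\<open>N\<close> is a ball about \<open>i\<close>, so it contains a ball
        about \<open>j\<close>, and continuity relative to \<open>N\<close> extends to all
        indices.\<close>
      have "k \<in> N" if "d j k < 1 / Suc n - d i j" for k
        using that tri[of i k j] by (simp add: N_def)
      then show "\<exists>r>0. \<forall>k\<in>UNIV. d j k < r \<longrightarrow> \<bar>g k - g j\<bar> < e"
        using r j by (intro exI[of _ "min r (1 / Suc n - d i j)"]) (auto simp: N_def)
    qed
  qed
  then show ?thesis using that by blast
qed

section \<open>From countable sets to open pieces of arbitrary subsets\<close>

context Metric_space
begin

text \<open>If every point of \<open>D\<close> is a discontinuity of some member of
  \<open>K\<close>, the same holds on a countable subset that contains, with each of its points, a
  sequence witnessing the failure there. An enumeration \<open>c\<close> transfers this to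
  \<open>nat\<close>; as \<open>c\<close> may repeat values, the pullback of \<open>d\<close> is
  only a pseudometric.\<close>

lemma common_continuity_point:
  assumes K: "compactin (powertop_real M) K" and conv: "convex_funs M K"
    and scat: "\<And>f A. f \<in> K \<Longrightarrow> A \<subseteq> M \<Longrightarrow> A \<noteq> {} \<Longrightarrow> \<exists>a\<in>A. cont_on_at d A f a"
    and D: "D \<subseteq> M" "D \<noteq> {}"
  shows "\<exists>x\<in>D. \<forall>f\<in>K. cont_on_at d D f x"
proof (rule ccontr)
  assume "\<not> ?thesis"
  then have "\<forall>x\<in>D. \<exists>f. f \<in> K \<and> \<not> cont_on_at d D f x" by blast
  then obtain F where F: "\<And>x. x \<in> D \<Longrightarrow> F x \<in> K" "\<And>x. x \<in> D \<Longrightarrow> \<not> cont_on_at d D (F x) x"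
    by (auto dest!: bchoice)
  \<comment> \<open>The radii \<open>1 / Suc n\<close> test all neighbourhoods of \<open>x\<close>
    with countably many witnesses.\<close>
  have "\<forall>x\<in>D. \<exists>e>0. \<forall>n. \<exists>y\<in>D. d x y < 1 / Suc n \<and> \<not> \<bar>F x y - F x x\<bar> < e"
  proof
    fix x assume "x \<in> D"
    then obtain e where e: "e > 0" "\<forall>r>0. \<exists>y\<in>D. d x y < r \<and> \<not> \<bar>F x y - F x x\<bar> < e"
      using F(2)[of x] unfolding cont_on_at_def by blast
    have "\<exists>y\<in>D. d x y < 1 / Suc n \<and> \<not> \<bar>F x y - F x x\<bar> < e" for n
      by (rule e(2)[rule_format]) simp
    then show "\<exists>e>0. \<forall>n. \<exists>y\<in>D. d x y < 1 / Suc n \<and> \<not> \<bar>F x y - F x x\<bar> < e"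
      using e(1) by blast
  qed
  then obtain e where e: "\<And>x. x \<in> D \<Longrightarrow> e x > 0"
    and e': "\<And>x n. x \<in> D \<Longrightarrow> \<exists>y\<in>D. d x y < 1 / Suc n \<and> \<not> \<bar>F x y - F x x\<bar> < e x"
    by (auto dest!: bchoice)
  define Y where "Y = (\<lambda>x n. SOME y. y \<in> D \<and> d x y < 1 / Suc n \<and> \<not> \<bar>F x y - F x x\<bar> < e x)"
  have Y_all: "Y x n \<in> D \<and> d x (Y x n) < 1 / Suc n \<and> \<not> \<bar>F x (Y x n) - F x x\<bar> < e x" if "x \<in> D" for x n
    unfolding Y_def by (rule someI_ex) (use e'[OF that, of n] in blast)
  then have Y: "\<And>x n. x \<in> D \<Longrightarrow> Y x n \<in> D"
      "\<And>x n. x \<in> D \<Longrightarrow> d x (Y x n) < 1 / Suc n"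
      "\<And>x n. x \<in> D \<Longrightarrow> \<not> \<bar>F x (Y x n) - F x x\<bar> < e x"
    by blast+
  obtain x0 where x0: "x0 \<in> D" using D by blast
  \<comment> \<open>The closure of \<open>x0\<close> under all \<open>Y x n\<close>: on it every \<open>F x\<close> is still discontinuous at \<open>x\<close>.\<close>
  define c :: "nat \<Rightarrow> 'a" where "c = (\<lambda>i. foldl Y x0 (from_nat i))"
  have foldl_D: "foldl Y x0 l \<in> D" for l
    by (induction l rule: rev_induct) (auto simp: x0 Y)
  then have c: "c i \<in> D" "c i \<in> M" for i using D by (auto simp: c_def)
  \<comment> \<open>Points are named by finite words over \<open>nat\<close>; appending
    \<open>n\<close> to a word applies \<open>Y\<close> with argument \<open>n\<close>.\<close>
  have c_Y: "\<exists>j. c j = Y (c i) n" for i n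
    by (rule exI[of _ "to_nat (from_nat i @ [n] :: nat list)"]) (simp add: c_def)
  define d' where "d' = (\<lambda>i j. d (c i) (c j))"
  have "\<exists>i. \<forall>h\<in>(\<lambda>f. f \<circ> c) ` K. cont_on_at d' UNIV h i"
  proof (rule common_continuity_point_nat[of d' "(\<lambda>f. f \<circ> c) ` K"])
    show "d' i i = 0" for i using c by (simp add: d'_def)
    show "d' i k \<le> d' i j + d' j k" for i j k using c triangle by (simp add: d'_def)
    have "continuous_map (powertop_real M) (powertop_real UNIV) (\<lambda>f. f \<circ> c)"
    proof (rule continuous_map_coordinatewise_then_product)
      show "continuous_map (powertop_real M) euclideanreal (\<lambda>f. (f \<circ> c) i)" for i
        using continuous_map_product_projection[of "c i" M "\<lambda>_. euclideanreal"] c by simp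
    qed auto
    then have "compactin (powertop_real UNIV) ((\<lambda>f. f \<circ> c) ` K)"
      using K image_compactin by blast
    then show "compact ((\<lambda>f. f \<circ> c) ` K)"
      by (simp add: euclidean_product_topology)
    show "(\<lambda>i. (1 - u) * f i + u * g i) \<in> (\<lambda>f. f \<circ> c) ` K"
      if fg: "f \<in> (\<lambda>f. f \<circ> c) ` K" "g \<in> (\<lambda>f. f \<circ> c) ` K" and u: "0 < u" "u < 1" for f g u
    proof -
      obtain f' g' where fg': "f' \<in> K" "g' \<in> K" "f = f' \<circ> c" "g = g' \<circ> c" using fg by blast
      then have "(\<lambda>x\<in>M. (1 - u) * f' x + u * g' x) \<in> K"
        using conv u unfolding convex_funs_def by simp
      moreover have "(\<lambda>i. (1 - u) * f i + u * g i) = (\<lambda>x\<in>M. (1 - u) * f' x + u * g' x) \<circ> c"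
        using c by (auto simp: fg')
      ultimately show ?thesis by blast
    qed
    show "\<exists>a\<in>A. cont_on_at d' A f a" if f: "f \<in> (\<lambda>f. f \<circ> c) ` K" and A: "A \<noteq> {}" for f A
    proof -
      obtain f' where f': "f' \<in> K" "f = f' \<circ> c" using f by blast
      then obtain a where "a \<in> A" "cont_on_at d (c ` A) f' (c a)"
        using scat[of f' "c ` A"] A c by blast
      then show ?thesis unfolding cont_on_at_def d'_def f' by auto
    qed
  qed blast
  then obtain i where i: "\<And>f. f \<in> K \<Longrightarrow> cont_on_at d' UNIV (f \<circ> c) i" by blast
  define x where "x = c i"
  have x: "x \<in> D" using c by (simp add: x_def)
  obtain r where r: "r > 0" "\<And>j. d x (c j) < r \<Longrightarrow> \<bar>F x (c j) - F x x\<bar> < e x"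
    using i[OF F(1)[OF x]] e[OF x] unfolding cont_on_at_def d'_def x_def by auto
  obtain n where "1 / Suc n < r" using r(1) nat_approx_posE by blast
  moreover obtain j where "c j = Y x n" using c_Y x_def by blast
  ultimately show False using r(2)[of j] Y(2,3)[OF x, of n] by auto
qed

text \<open>The set \<open>D\<close> of bad points is not dense in \<open>A\<close>: at a common
  point of continuity relative to a dense \<open>D\<close>, every member of \<open>K\<close> would
  be continuous relative to all of \<open>A\<close>. A ball that meets \<open>A\<close> and misses
  \<open>D\<close> gives the open set.\<close>

lemma common_continuity_open:
  assumes K: "compactin (powertop_real M) K" and conv: "convex_funs M K"
    and scat: "\<And>f A. f \<in> K \<Longrightarrow> A \<subseteq> M \<Longrightarrow> A \<noteq> {} \<Longrightarrow> \<exists>a\<in>A. cont_on_at d A f a"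
    and A: "A \<subseteq> M" "A \<noteq> {}"
  shows "\<exists>U. openin mtopology U \<and> A \<inter> U \<noteq> {} \<and> (\<forall>x\<in>A \<inter> U. \<forall>f\<in>K. cont_on_at d (A \<inter> U) f x)"
proof -
  define D where "D = {x \<in> A. \<exists>f\<in>K. \<not> cont_on_at d A f x}"
  have "\<exists>x\<in>A. \<exists>r>0. mball x r \<inter> D = {}"
  proof (rule ccontr)
    assume "\<not> ?thesis"
    then have dense: "\<exists>y\<in>D. d x y < r" if "x \<in> A" "r > 0" for x r
      using that A by fastforce
    then have "D \<noteq> {}" using A zero_less_one by blast
    moreover have "D \<subseteq> M" using A by (auto simp: D_def)
    ultimately obtain x where x: "x \<in> D" and cont_D: "\<And>f. f \<in> K \<Longrightarrow> cont_on_at d D f x"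
      using common_continuity_point[OF K conv scat] by metis
    then obtain f where f: "f \<in> K" "\<not> cont_on_at d A f x" unfolding D_def by blast
    then obtain e where e: "e > 0" "\<And>r. r > 0 \<Longrightarrow> \<exists>y\<in>A. d x y < r \<and> \<not> \<bar>f y - f x\<bar> < e"
      unfolding cont_on_at_def by blast
    obtain r where r: "r > 0" "\<And>y. y \<in> D \<Longrightarrow> d x y < r \<Longrightarrow> \<bar>f y - f x\<bar> < e/2"
      using cont_D[OF f(1)] e(1) unfolding cont_on_at_def by (meson half_gt_zero)
    obtain y where y: "y \<in> A" "d x y < r" "\<not> \<bar>f y - f x\<bar> < e" using e(2) r(1) by blast
    \<comment> \<open>\<open>f\<close> is far from \<open>f x\<close> at \<open>y\<close> but close to it on \<open>D\<close>, so \<open>y\<close> is a point of continuity of \<open>f\<close>;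
      yet points of \<open>D\<close> come arbitrarily near \<open>y\<close>.\<close>
    have "y \<notin> D" using r(2)[of y] y e(1) by auto
    then have "cont_on_at d A f y" using y(1) f(1) unfolding D_def by blast
    then obtain s where s: "s > 0" "\<And>z. z \<in> A \<Longrightarrow> d y z < s \<Longrightarrow> \<bar>f z - f y\<bar> < e/2"
      using e(1) unfolding cont_on_at_def by (meson half_gt_zero)
    obtain z where z: "z \<in> D" "d y z < min s (r - d x y)"
      using dense[of y "min s (r - d x y)"] y s(1) by auto
    have "d x z \<le> d x y + d y z" using triangle \<open>D \<subseteq> M\<close> x y(1) z(1) A by blast
    then have "\<bar>f z - f x\<bar> < e/2" using r(2) z by auto
    moreover have "\<bar>f z - f y\<bar> < e/2" using s(2) z D_def by auto
    ultimately show False using y(3) by (simp add: abs_if split: if_splits)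
  qed
  then obtain x r where x: "x \<in> A" "r > 0" "mball x r \<inter> D = {}" by blast
  show ?thesis
  proof (intro exI conjI ballI)
    show "openin mtopology (mball x r)" by simp
    show "A \<inter> mball x r \<noteq> {}" using x A by auto
    show "cont_on_at d (A \<inter> mball x r) f y" if "y \<in> A \<inter> mball x r" "f \<in> K" for y f
    proof -
      have "cont_on_at d A f y" using x(3) that unfolding D_def by blast
      then show ?thesis unfolding cont_on_at_def by (meson IntD1)
    qed
  qed
qed

section \<open>Countable separating sets\<close>

lemma separable_imp_second_countable:
  assumes "separable_space mtopology"
  shows "second_countable mtopology"
proof -
  obtain C where C: "countable C" "C \<subseteq> M" "mtopology closure_of C = M"
    using assms unfolding separable_space_def by auto
  let ?B = "(\<lambda>(c, n :: nat). mball c (1 / Suc n)) ` (C \<times> UNIV)"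
  have "\<exists>V\<in>?B. x \<in> V \<and> V \<subseteq> U" if U: "openin mtopology U" "x \<in> U" for U x
  proof -
    obtain r where r: "r > 0" "mball x r \<subseteq> U" using U openin_mtopology by blast
    have x: "x \<in> M" using U openin_mtopology by blast
    obtain n where n: "1 / Suc n < r / 2" using nat_approx_posE[of "r/2"] r by auto
    have "x \<in> mtopology closure_of C" using C x by simp
    then obtain c where c: "c \<in> C" "c \<in> mball x (1 / Suc n)"
      unfolding metric_closure_of using of_nat_0_less_iff by (smt (verit) mem_Collect_eq zero_less_Suc zero_less_divide_1_iff)
    then have "x \<in> mball c (1 / Suc n)" by (simp add: commute)
    moreover have "mball c (1 / Suc n) \<subseteq> mball x r"
    proof
      fix y assume "y \<in> mball c (1 / Suc n)"
      then show "y \<in> mball x r" using c n triangle[of x c y] by auto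
    qed
    ultimately show ?thesis using c(1) r(2) by blast
  qed
  moreover have "countable ?B" using C by blast
  ultimately show ?thesis
    unfolding second_countable_def by (intro exI[of _ ?B]) (auto simp del: in_mball)
qed

lemma cont_on_at_determined_by_dense:
  assumes S: "S \<subseteq> A" "A \<subseteq> mtopology closure_of S"
    and cont: "cont_on_at d A f x" "cont_on_at d A g x" and x: "x \<in> A"
    and eq: "\<And>s. s \<in> S \<Longrightarrow> f s = g s"
  shows "f x = g x"
proof (rule ccontr)
  assume "f x \<noteq> g x"
  then have e: "\<bar>f x - g x\<bar> / 2 > 0" by simp
  obtain r where r: "r > 0" "\<forall>y\<in>A. d x y < r \<longrightarrow> \<bar>f y - f x\<bar> < \<bar>f x - g x\<bar> / 2"
    using cont(1) e unfolding cont_on_at_def by blast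
  obtain s where s: "s > 0" "\<forall>y\<in>A. d x y < s \<longrightarrow> \<bar>g y - g x\<bar> < \<bar>f x - g x\<bar> / 2"
    using cont(2) e unfolding cont_on_at_def by blast
  have "x \<in> mtopology closure_of S" using S x by blast
  then have "\<exists>y\<in>S. y \<in> mball x t" if "t > 0" for t
    using that unfolding metric_closure_of by blast
  from this[of "min r s"] obtain y where y: "y \<in> S" "y \<in> mball x (min r s)"
    using r(1) s(1) by auto
  then have "\<bar>f y - f x\<bar> < \<bar>f x - g x\<bar> / 2" "\<bar>g y - g x\<bar> < \<bar>f x - g x\<bar> / 2"
    using r s S by auto
  then show False using eq[OF y(1)] by (simp add: abs_if split: if_splits)
qed

text \<open>A maximal open set replaces transfinite removal: \<open>W\<close> is the union of all
  open sets on which countably many values determine each member of \<open>K\<close>. By the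
  Lindelof property \<open>W\<close> is itself such a set, and an open piece of its complement would
  enlarge it.\<close>

lemma countable_separating_set:
  assumes sc: "second_countable mtopology"
    and K: "compactin (powertop_real M) K" and conv: "convex_funs M K"
    and scat: "\<And>f A. f \<in> K \<Longrightarrow> A \<subseteq> M \<Longrightarrow> A \<noteq> {} \<Longrightarrow> \<exists>a\<in>A. cont_on_at d A f a"
  shows "\<exists>S. countable S \<and> S \<subseteq> M \<and>
    (\<forall>f\<in>K. \<forall>g\<in>K. (\<forall>s\<in>S. f s = g s) \<longrightarrow> (\<forall>x\<in>M. f x = g x))"
proof -
  define determines where "determines = (\<lambda>S W. \<forall>f\<in>K. \<forall>g\<in>K. (\<forall>s\<in>S. f s = g s) \<longrightarrow> (\<forall>x\<in>W. f x = g x))"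
  define \<W> where "\<W> = {W. openin mtopology W \<and> (\<exists>S. countable S \<and> S \<subseteq> M \<and> determines S W)}"
  define W where "W = \<Union>\<W>"
  have "openin mtopology W" unfolding W_def \<W>_def by (rule openin_Union) auto
  have "Lindelof_space (subtopology mtopology W)"
    using sc by (simp add: second_countable_imp_Lindelof_space second_countable_subtopology)
  moreover have "\<forall>U\<in>\<W>. openin mtopology U" "topspace mtopology \<inter> W \<subseteq> \<Union>\<W>"
    by (auto simp: \<W>_def W_def)
  ultimately obtain \<V> where \<V>: "countable \<V>" "\<V> \<subseteq> \<W>" "topspace mtopology \<inter> W \<subseteq> \<Union>\<V>"
    unfolding Lindelof_space_subtopology by meson
  have "\<forall>V\<in>\<V>. \<exists>S. countable S \<and> S \<subseteq> M \<and> determines S V"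
    using \<V>(2) unfolding \<W>_def by blast
  then obtain s where s: "\<And>V. V \<in> \<V> \<Longrightarrow> countable (s V) \<and> s V \<subseteq> M \<and> determines (s V) V"
    by metis
  define S where "S = (\<Union>V\<in>\<V>. s V)"
  have S: "countable S" "S \<subseteq> M" using \<V>(1) s by (auto simp: S_def)
  have "W \<subseteq> M" using \<open>openin mtopology W\<close> openin_mtopology by blast
  have det: "determines S W"
    unfolding determines_def
  proof (intro ballI impI)
    fix f g x assume fg: "f \<in> K" "g \<in> K" "\<forall>s\<in>S. f s = g s" and "x \<in> W"
    then obtain V where "V \<in> \<V>" "x \<in> V" using \<V>(3) \<open>W \<subseteq> M\<close> by auto
    moreover have "\<forall>t\<in>s V. f t = g t" using fg(3) \<open>V \<in> \<V>\<close> by (auto simp: S_def)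
    moreover have "determines (s V) V" using s \<open>V \<in> \<V>\<close> by blast
    ultimately show "f x = g x" using fg(1,2) unfolding determines_def by blast
  qed
  have "W = M"
  proof (rule ccontr)
    assume "W \<noteq> M"
    then have "M - W \<noteq> {}" using \<open>W \<subseteq> M\<close> by blast
    have "\<exists>U. openin mtopology U \<and> (M - W) \<inter> U \<noteq> {} \<and>
        (\<forall>x\<in>(M - W) \<inter> U. \<forall>f\<in>K. cont_on_at d ((M - W) \<inter> U) f x)"
    proof (rule common_continuity_open[OF K conv])
      show "\<exists>a\<in>A. cont_on_at d A f a" if "f \<in> K" "A \<subseteq> M" "A \<noteq> {}" for f A
        by (rule scat[OF that])
    qed (use \<open>M - W \<noteq> {}\<close> in auto)
    then obtain U where U: "openin mtopology U" "(M - W) \<inter> U \<noteq> {}"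
      and cont: "\<forall>x\<in>(M - W) \<inter> U. \<forall>f\<in>K. cont_on_at d ((M - W) \<inter> U) f x"
      by (elim exE conjE)
    let ?A = "(M - W) \<inter> U"
    have "separable_space (subtopology mtopology ?A)"
      using sc by (simp add: second_countable_imp_separable_space second_countable_subtopology)
    moreover have topspace_A: "topspace (subtopology mtopology ?A) = ?A" by auto
    ultimately obtain T where T: "countable T" "T \<subseteq> ?A" "subtopology mtopology ?A closure_of T = ?A"
      unfolding separable_space_def topspace_A by blast
    have dense: "?A \<subseteq> mtopology closure_of T"
      using closure_of_subtopology_subset[of mtopology ?A T] T(3) by blast
    \<comment> \<open>\<open>?A\<close> need not be open, so all of \<open>U\<close> is adjoined to
      \<open>W\<close>; the new points lie in \<open>?A\<close>, where \<open>f\<close> and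
      \<open>g\<close> are continuous and agree on the dense set \<open>T\<close>.\<close>
    have "determines (S \<union> T) (W \<union> U)"
      unfolding determines_def
    proof (intro ballI impI)
      fix f g x assume fg: "f \<in> K" "g \<in> K" "\<forall>s\<in>S \<union> T. f s = g s" and x: "x \<in> W \<union> U"
      show "f x = g x"
      proof (cases "x \<in> W")
        case True
        have "\<forall>s\<in>S. f s = g s" using fg(3) by blast
        then show ?thesis using det fg(1,2) True unfolding determines_def by blast
      next
        case False
        then have x: "x \<in> ?A" using x U(1) openin_mtopology by blast
        show ?thesis
          by (rule cont_on_at_determined_by_dense[OF T(2) dense cont[rule_format, OF x fg(1)]
                cont[rule_format, OF x fg(2)] x])
            (use fg(3) in blast)
      qed
    qed
    moreover have "openin mtopology (W \<union> U)" using U(1) \<open>openin mtopology W\<close> by blast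
    moreover have "countable (S \<union> T)" "S \<union> T \<subseteq> M" using S T by auto
    ultimately have "W \<union> U \<in> \<W>" unfolding \<W>_def mem_Collect_eq by blast
    then show False using U(2) unfolding W_def by blast
  qed
  then show ?thesis using S det unfolding determines_def by blast
qed

section \<open>Passage to topological notions and metrizability\<close>

lemma topcontinuous_at_imp_cont_on_at:
  assumes "A \<subseteq> M" "topcontinuous_at (subtopology mtopology A) euclideanreal f x"
  shows "cont_on_at d A f x"
  unfolding cont_on_at_def
proof (intro allI impI)
  fix e :: real assume "e > 0"
  then obtain U where U: "openin (subtopology mtopology A) U" "x \<in> U" "\<And>y. y \<in> U \<Longrightarrow> f y \<in> ball (f x) e"
    using assms(2) unfolding topcontinuous_at_def by (metis open_ball open_openin centre_in_ball)
  then obtain T where T: "openin mtopology T" "U = T \<inter> A" unfolding openin_subtopology by blast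
  then obtain r where r: "r > 0" "mball x r \<subseteq> T" using U(2) openin_mtopology by blast
  have "\<bar>f y - f x\<bar> < e" if "y \<in> A" "d x y < r" for y
  proof -
    have "y \<in> U" using that r T U(2) assms(1) in_mball by blast
    then show ?thesis using U(3)[of y] by (simp add: dist_real_def abs_minus_commute)
  qed
  then show "\<exists>r>0. \<forall>y\<in>A. d x y < r \<longrightarrow> \<bar>f y - f x\<bar> < e" using r by blast
qed

end

text \<open>Restriction to \<open>S\<close> is a continuous injection of a compact space into a
  Hausdorff space, hence an embedding; countability of \<open>S\<close> makes the target
  metrizable.\<close>

lemma metrizable_space_compact_separated:
  fixes K :: "('a \<Rightarrow> real) set"
  assumes K: "compactin (powertop_real I) K" and S: "countable S" "S \<subseteq> I"
    and sep: "\<forall>f\<in>K. \<forall>g\<in>K. (\<forall>s\<in>S. f s = g s) \<longrightarrow> (\<forall>x\<in>I. f x = g x)"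
  shows "metrizable_space (subtopology (powertop_real I) K)"
proof -
  let ?X = "subtopology (powertop_real I) K" and ?\<rho> = "\<lambda>f. restrict f S"
  have KI: "K \<subseteq> extensional I" using compactin_subset_topspace[OF K] by (auto simp: PiE_def)
  have met: "metrizable_space (powertop_real S)"
    using S(1) by (simp add: metrizable_space_product_topology metrizable_space_euclidean)
  have "embedding_map ?X (powertop_real S) ?\<rho>"
  proof (rule continuous_imp_embedding_map)
    show "continuous_map ?X (powertop_real S) ?\<rho>"
      
    proof (rule continuous_map_from_subtopology, rule continuous_map_coordinatewise_then_product)
      show "continuous_map (powertop_real I) euclideanreal (\<lambda>f. restrict f S i)" if "i \<in> S" for i
        using continuous_map_product_projection[of i I "\<lambda>_. euclideanreal"] that S(2) by auto
    qed auto
    show "compact_space ?X" using K by (simp add: compactin_subspace)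
    show "Hausdorff_space (powertop_real S)" by (simp add: metrizable_imp_Hausdorff_space met)
    show "inj_on ?\<rho> (topspace ?X)"
    proof (rule inj_onI)
      fix f g assume fg: "f \<in> topspace ?X" "g \<in> topspace ?X" "restrict f S = restrict g S"
      then have "f s = g s" if "s \<in> S" for s using that by (metis restrict_apply')
      then have "f x = g x" if "x \<in> I" for x using sep fg that by auto
      \<comment> \<open>Agreement on \<open>I\<close> is equality because members of
        \<open>K\<close> are extensional.\<close>
      then show "f = g" using fg KI by (intro extensionalityI[of f I g]) auto
    qed
  qed
  then have "?X homeomorphic_space subtopology (powertop_real S) (?\<rho> ` topspace ?X)"
    unfolding embedding_map_def by (rule homeomorphic_map_imp_homeomorphic_space)
  then show ?thesis
    using homeomorphic_metrizable_space metrizable_space_subtopology[OF met] by blast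
qed

theorem corollary3:
  fixes X :: "'a topology" and K :: "('a \<Rightarrow> real) set"
  assumes "metrizable_space X" and "separable_space X"
    and "compactin (SC_p X) K" and "convex_funs (topspace X) K"
  shows "metrizable_space (subtopology (SC_p X) K)"
proof -
  obtain M d where "Metric_space M d" and X: "X = Metric_space.mtopology M d"
    using assms(1) unfolding metrizable_space_def by blast
  then interpret Metric_space M d by simp
  have K: "compactin (powertop_real M) K" "\<And>f. f \<in> K \<Longrightarrow> scatteredly_continuous X euclideanreal f"
    using assms(3) by (auto simp: SC_p_def compactin_subtopology X)
  have scat: "\<exists>a\<in>A. cont_on_at d A f a" if "f \<in> K" "A \<subseteq> M" "A \<noteq> {}" for f A
    using K(2)[OF that(1)] that(2,3) topcontinuous_at_imp_cont_on_at[OF that(2)]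
    unfolding scatteredly_continuous_def X topspace_mtopology by blast
  have "second_countable mtopology"
    using separable_imp_second_countable assms(2) X by simp
  moreover have "convex_funs M K" using assms(4) by (simp add: X)
  ultimately obtain S where "countable S" "S \<subseteq> M"
    "\<forall>f\<in>K. \<forall>g\<in>K. (\<forall>s\<in>S. f s = g s) \<longrightarrow> (\<forall>x\<in>M. f x = g x)"
    using countable_separating_set[OF _ K(1) _ scat] by blast
  then have "metrizable_space (subtopology (powertop_real M) K)"
    using metrizable_space_compact_separated[OF K(1)] by blast
  \<comment> \<open>All members of \<open>K\<close> are scatteredly continuous, so \<open>K\<close>
    has the same subspace topology in \<open>SC_p X\<close> as in the full product.\<close>
  moreover have "{f. scatteredly_continuous X euclideanreal f} \<inter> K = K" using K(2) by blast
  then have "subtopology (SC_p X) K = subtopology (powertop_real M) K"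
    by (simp add: SC_p_def subtopology_subtopology X)
  ultimately show ?thesis by simp
qed

end
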